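(* Let $\mathcal V$ be a real Hilbert space with norm $\|\cdot\|$ and dual $\mathcal V'$ with norm $\|\cdot\|_*$. Let $W\subset\mathcal V$ be a finite dimensional subspace with basis $\{e_n\}_{n=1}^N$, let $P:\mathcal V\to W$ be a bounded linear projector, let $W^*=\operatorname{Im}(P^* )\subset\mathcal V'$, and let $\{\eta_n\}_{n=1}^N$ be the basis of $W^*$ with $\langle\eta_n,e_\ell\rangle=\delta_{n,\ell}$. Let $\mathbf S\in\mathbb R^{N\times N}$ be a symmetric positive definite matrix such that the bilinear form $s(v,w)=\vec w^{\,T}\mathbf S\vec v$ on $W\times W$ satisfies, for positive constants $K_\star,\kappa_\star$, $$s(v,w)\le K_\star\|v\|\,\|w\|,\qquad s(v,v)\ge\kappa_\star\|v\|^2\qquad\forall v,w\in W .$$ Define $\widetilde s:W^*\times W^*\to\mathbb R$ by $\widetilde s(\eta,\zeta)=\vec\eta^{\,T}\mathbf S^{-1}\vec\zeta$. Then for all $\eta,\zeta\in W^*$ $$\widetilde s(\eta,\zeta)\le\kappa_\star^{-1}\|\eta\|_*\|\zeta\|_*,\qquad \widetilde s(\eta,\eta)\ge\|P\|^{-2}K_\star^{-1}\|\eta\|_*^2 .$$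
   Context: $\langle\cdot,\cdot\rangle$ is the duality pairing between $\mathcal V'$ and $\mathcal V$, $\|\eta\|_*=\sup_{v\in\mathcal V,\,v\neq0}\langle\eta,v\rangle/\|v\|$, and $\|P\|=\sup_{v\in\mathcal V,\,v\neq0}\|Pv\|/\|v\|$. A projector $P:\mathcal V\to W$ is a linear map onto $W$ with $Pw=w$ for $w\in W$; $P^*:\mathcal V'\to\mathcal V'$ is its adjoint, $\langle P^*\zeta,v\rangle=\langle\zeta,Pv\rangle$, which is itself a projector, with image $W^*$. The space $W^*$ has a basis $\{\eta_n\}_{n=1}^N$ biorthogonal to $\{e_n\}$. For $v=\sum_n v_ne_n\in W$ and $\zeta=\sum_n\zeta_n\eta_n\in W^*$, $\vec v=(v_n)\in\mathbb R^N$ and $\vec\zeta=(\zeta_n)\in\mathbb R^N$ denote the coefficient vectors. *)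

theory Defs
  imports "HOL-Analysis.Analysis"
begin

(* The dual V' of V is the type of bounded linear maps from V to the reals, the pairing is
   application, and the dual norm is the operator norm. The library norm is a supremum of
   \<bar>\<eta> v\<bar> / norm v; by the symmetry v \<mapsto> -v this is the supremum of \<eta> v / norm v. *)

definition is_basis :: "('n::finite \<Rightarrow> 'b::real_vector) \<Rightarrow> 'b set \<Rightarrow> bool" where
  "is_basis b U \<longleftrightarrow> inj b \<and> independent (range b) \<and> span (range b) = U"

(* Meaningful only for v in the span of an injective linearly independent family b. *)
definition coeffs :: "('n::finite \<Rightarrow> 'b::real_vector) \<Rightarrow> 'b \<Rightarrow> real ^ 'n" where
  "coeffs b v = (\<chi> n. representation (range b) v (b n))"

definition is_projector :: "('a::real_normed_vector \<Rightarrow>\<^sub>L 'a) \<Rightarrow> 'a set \<Rightarrow> bool" where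
  "is_projector P W \<longleftrightarrow> range (blinfun_apply P) = W \<and> (\<forall>w\<in>W. blinfun_apply P w = w)"

(* Adjoint between dual spaces: <P* z, v> = <z, P v>. *)
definition dual_adjoint ::
    "('a::real_normed_vector \<Rightarrow>\<^sub>L 'a) \<Rightarrow> ('a \<Rightarrow>\<^sub>L real) \<Rightarrow> ('a \<Rightarrow>\<^sub>L real)" where
  "dual_adjoint P \<zeta> = \<zeta> o\<^sub>L P"

definition sym_pos_def :: "real ^ 'n ^ 'n \<Rightarrow> bool" where
  "sym_pos_def S \<longleftrightarrow> transpose S = S \<and> (\<forall>x. x \<noteq> 0 \<longrightarrow> 0 < x \<bullet> (S *v x))"

definition s_form ::
    "('n::finite \<Rightarrow> 'a::real_vector) \<Rightarrow> real ^ 'n ^ 'n \<Rightarrow> 'a \<Rightarrow> 'a \<Rightarrow> real" where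
  "s_form e S v w = coeffs e w \<bullet> (S *v coeffs e v)"

definition s_dual_form ::
    "('n::finite \<Rightarrow> ('a::real_normed_vector \<Rightarrow>\<^sub>L real)) \<Rightarrow> real ^ 'n ^ 'n
      \<Rightarrow> ('a \<Rightarrow>\<^sub>L real) \<Rightarrow> ('a \<Rightarrow>\<^sub>L real) \<Rightarrow> real" where
  "s_dual_form \<eta> S \<xi> \<zeta> = coeffs \<eta> \<xi> \<bullet> (matrix_inv S *v coeffs \<eta> \<zeta>)"

end

theory Submission
  imports Defs
begin

text \<open>The Riesz representative \<open>r \<in> W\<close> of \<open>\<zeta> \<in> W\<^sup>*\<close> with respect to the inner product \<open>s\<close> has
  coefficient vector \<open>S\<^sup>-\<^sup>1\<close> times that of \<open>\<zeta>\<close>, so the dual form of \<open>\<xi>\<close> and \<open>\<zeta>\<close> is \<open>\<xi> r\<close>, and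
  coercivity of \<open>s\<close> gives \<open>\<kappa> \<parallel>r\<parallel> \<le> \<parallel>\<zeta>\<parallel>\<close>. Since \<open>\<zeta> v = \<zeta> (P v) = s (P v, r)\<close>, the Cauchy-Schwarz
  inequality for \<open>s\<close> and its continuity bound \<open>\<parallel>\<zeta>\<parallel>\<^sup>2\<close> by \<open>K \<parallel>P\<parallel>\<^sup>2 s (r, r)\<close>.\<close>

lemma sum_coeffs:
  assumes "is_basis b U" "v \<in> U"
  shows "(\<Sum>n\<in>UNIV. coeffs b v $ n *\<^sub>R b n) = v"
proof -
  have "(\<Sum>n\<in>UNIV. coeffs b v $ n *\<^sub>R b n)
      = (\<Sum>w\<in>range b. representation (range b) v w *\<^sub>R w)"
    using assms by (simp add: is_basis_def coeffs_def sum.reindex)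
  also have "\<dots> = v"
    using assms by (intro real_vector.sum_representation_eq) (auto simp: is_basis_def)
  finally show ?thesis .
qed

lemma coeffs_sum:
  assumes "is_basis b U"
  shows "coeffs b (\<Sum>n\<in>UNIV. c $ n *\<^sub>R b n) = c"
proof -
  have b: "inj b" "independent (range b)"
    using assms by (auto simp: is_basis_def)
  have "representation (range b) (\<Sum>n\<in>UNIV. c $ n *\<^sub>R b n) (b m) = c $ m" for m
  proof -
    have "representation (range b) (\<Sum>n\<in>UNIV. c $ n *\<^sub>R b n) (b m)
        = (\<Sum>n\<in>UNIV. c $ n * (if b m = b n then 1 else 0))"
      using b
      by (simp add: real_vector.representation_sum real_vector.representation_scale
          real_vector.span_scale real_vector.span_base real_vector.representation_basis)
    also have "\<dots> = c $ m"
      using b(1) by (simp add: inj_eq if_distrib cong: if_cong)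
    finally show ?thesis .
  qed
  then show ?thesis
    by (simp add: coeffs_def vec_eq_iff)
qed

lemma sum_in_basis:
  assumes "is_basis b U"
  shows "(\<Sum>n\<in>UNIV. c n *\<^sub>R b n) \<in> U"
proof -
  have "(\<Sum>n\<in>UNIV. c n *\<^sub>R b n) \<in> span (range b)"
    by (intro real_vector.span_sum real_vector.span_scale real_vector.span_base rangeI)
  then show ?thesis
    using assms by (simp add: is_basis_def)
qed

text \<open>Expanding both arguments gives a double sum in which biorthogonality keeps only the
  diagonal. This moves the duality pairing into Euclidean coordinates, where \<open>S\<close> and
  its inverse act.\<close>

lemma biorthogonal_pairing:
  assumes "is_basis e W" "is_basis \<eta> V" "v \<in> W" "\<zeta> \<in> V"
    and "\<And>n l. blinfun_apply (\<eta> n) (e l) = (if n = l then 1 else 0)"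
  shows "blinfun_apply \<zeta> v = coeffs \<eta> \<zeta> \<bullet> coeffs e v"
proof -
  have "blinfun_apply \<zeta> v = blinfun_apply (\<Sum>n\<in>UNIV. coeffs \<eta> \<zeta> $ n *\<^sub>R \<eta> n)
      (\<Sum>l\<in>UNIV. coeffs e v $ l *\<^sub>R e l)"
    using assms sum_coeffs by metis
  also have "\<dots> = (\<Sum>l\<in>UNIV. \<Sum>n\<in>UNIV.
      coeffs e v $ l * (coeffs \<eta> \<zeta> $ n * (if n = l then 1 else 0)))"
    by (simp add: blinfun.sum_left blinfun.sum_right blinfun.scaleR_left blinfun.scaleR_right
        assms(5) sum_distrib_left)
  also have "\<dots> = coeffs \<eta> \<zeta> \<bullet> coeffs e v"
    by (simp add: inner_vec_def if_distrib mult.commute cong: if_cong)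
  finally show ?thesis .
qed

lemma sym_pos_def_nonneg: "sym_pos_def S \<Longrightarrow> 0 \<le> x \<bullet> (S *v x)"
  by (cases "x = 0") (auto simp: sym_pos_def_def intro: less_imp_le)

lemma sym_pos_def_inner_commute:
  assumes "sym_pos_def S"
  shows "x \<bullet> (S *v y) = y \<bullet> (S *v x)"
  using assms dot_lmul_matrix[of x S y]
  by (metis inner_commute sym_pos_def_def vector_transpose_matrix)

text \<open>A kernel vector has zero quadratic form, so definiteness makes the kernel trivial, which
  suffices for a square matrix.\<close>

lemma sym_pos_def_invertible:
  fixes S :: "real ^ 'n ^ 'n"
  assumes "sym_pos_def S"
  shows "invertible S"
proof -
  have "\<forall>x. S *v x = 0 \<longrightarrow> x = 0"
    using assms by (metis inner_zero_right less_irrefl sym_pos_def_def)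
  then show ?thesis
    by (simp add: invertible_left_inverse matrix_left_invertible_ker)
qed

text \<open>\<open>matrix_inv\<close> is a Hilbert choice among two-sided inverses, and
  invertibility provides one to choose.\<close>

lemma matrix_inv_right:
  assumes "invertible A"
  shows "A ** matrix_inv A = mat 1"
  using someI_ex[OF assms[unfolded invertible_def]] by (simp add: matrix_inv_def)

lemma sym_pos_def_Cauchy_Schwarz:
  assumes "sym_pos_def S"
  shows "(x \<bullet> (S *v y))\<^sup>2 \<le> (x \<bullet> (S *v x)) * (y \<bullet> (S *v y))"
proof (cases "y = 0")
  case False
  then have y: "0 < y \<bullet> (S *v y)"
    using assms by (simp add: sym_pos_def_def)
  \<comment> \<open>This \<open>t\<close> minimizes the quadratic form along the line of all
    \<open>x - t y\<close>; its nonnegativity at the minimum is the claim divided by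
    \<open>y \<bullet> (S *v y)\<close>.\<close>
  define t where "t = (x \<bullet> (S *v y)) / (y \<bullet> (S *v y))"
  have "0 \<le> (x - t *\<^sub>R y) \<bullet> (S *v (x - t *\<^sub>R y))"
    using assms by (rule sym_pos_def_nonneg)
  also have "\<dots> = x \<bullet> (S *v x) - 2 * t * (x \<bullet> (S *v y)) + t\<^sup>2 * (y \<bullet> (S *v y))"
    using sym_pos_def_inner_commute[OF assms, of y x]
    by (simp add: matrix_vector_mult_diff_distrib scaleR_matrix_vector_assoc[symmetric]
        matrix_vector_mult_scaleR inner_diff_left inner_diff_right algebra_simps power2_eq_square)
  also have "\<dots> = x \<bullet> (S *v x) - (x \<bullet> (S *v y))\<^sup>2 / (y \<bullet> (S *v y))"
    using y by (simp add: t_def field_simps power2_eq_square)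
  finally show ?thesis
    using y by (simp add: field_simps)
qed simp

theorem proposition4p5:
  fixes W :: "'a::{real_inner, complete_space} set"
    and e :: "'n::finite \<Rightarrow> 'a"
    and P :: "'a \<Rightarrow>\<^sub>L 'a"
    and Wstar :: "('a \<Rightarrow>\<^sub>L real) set"
    and \<eta> :: "'n \<Rightarrow> ('a \<Rightarrow>\<^sub>L real)"
    and S :: "real ^ 'n ^ 'n"
    and K \<kappa> :: real
  assumes "subspace W"
    and "is_basis e W"
    and "is_projector P W"
    and "Wstar = range (dual_adjoint P)"
    and "is_basis \<eta> Wstar"
    and "\<forall>n l. blinfun_apply (\<eta> n) (e l) = (if n = l then 1 else 0)"
    and "sym_pos_def S"
    and "0 < K" and "0 < \<kappa>"
    and "\<forall>v\<in>W. \<forall>w\<in>W. s_form e S v w \<le> K * norm v * norm w"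
    and "\<forall>v\<in>W. s_form e S v v \<ge> \<kappa> * (norm v)\<^sup>2"
  shows "\<forall>\<xi>\<in>Wstar. \<forall>\<zeta>\<in>Wstar.
      s_dual_form \<eta> S \<xi> \<zeta> \<le> inverse \<kappa> * norm \<xi> * norm \<zeta> \<and>
      s_dual_form \<eta> S \<xi> \<xi> \<ge> inverse ((norm P)\<^sup>2) * inverse K * (norm \<xi>)\<^sup>2"
proof -
  define r where "r \<zeta> = (\<Sum>n\<in>UNIV. (matrix_inv S *v coeffs \<eta> \<zeta>) $ n *\<^sub>R e n)" for \<zeta>
  have r_W: "r \<zeta> \<in> W" for \<zeta>
    unfolding r_def using assms(2) by (rule sum_in_basis)
  have coeffs_r: "coeffs e (r \<zeta>) = matrix_inv S *v coeffs \<eta> \<zeta>" for \<zeta>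
    unfolding r_def using assms(2) by (rule coeffs_sum)
  have S_r: "S *v coeffs e (r \<zeta>) = coeffs \<eta> \<zeta>" for \<zeta>
    by (simp add: coeffs_r matrix_vector_mul_assoc
        matrix_inv_right[OF sym_pos_def_invertible[OF assms(7)]])
  have pair: "blinfun_apply \<zeta> v = coeffs \<eta> \<zeta> \<bullet> coeffs e v" if "\<zeta> \<in> Wstar" "v \<in> W" for \<zeta> v
    using assms(6) by (intro biorthogonal_pairing[OF assms(2,5) that(2,1)]) simp
  have dual: "s_dual_form \<eta> S \<xi> \<zeta> = blinfun_apply \<xi> (r \<zeta>)" if "\<xi> \<in> Wstar" for \<xi> \<zeta>
    using pair[OF that r_W, of \<zeta>] by (simp add: s_dual_form_def coeffs_r)
  \<comment> \<open>With \<open>r \<zeta>\<close> as first argument of \<open>s_form\<close>,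
    \<open>S\<close> acts directly on its coefficients and cancels the inverse.\<close>
  have riesz: "s_form e S (r \<zeta>) v = blinfun_apply \<zeta> v" if "\<zeta> \<in> Wstar" "v \<in> W" for \<zeta> v
    using pair[OF that] by (simp add: s_form_def S_r inner_commute)
  have upper: "s_dual_form \<eta> S \<xi> \<zeta> \<le> inverse \<kappa> * norm \<xi> * norm \<zeta>"
    if "\<xi> \<in> Wstar" "\<zeta> \<in> Wstar" for \<xi> \<zeta>
  proof -
    \<comment> \<open>Coercivity is tested at \<open>r \<zeta>\<close> itself, where the form equals
      the pairing with \<open>\<zeta>\<close>.\<close>
    have "\<kappa> * (norm (r \<zeta>))\<^sup>2 \<le> blinfun_apply \<zeta> (r \<zeta>)"
      using assms(11) r_W by (simp flip: riesz[OF that(2) r_W])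
    also have "\<dots> \<le> norm \<zeta> * norm (r \<zeta>)"
      using norm_blinfun[of \<zeta> "r \<zeta>"] by simp
    finally have "norm (r \<zeta>) * (\<kappa> * norm (r \<zeta>)) \<le> norm (r \<zeta>) * norm \<zeta>"
      by (simp add: power2_eq_square algebra_simps)
    \<comment> \<open>The common factor can be cancelled unless \<open>r \<zeta> = 0\<close>, and
      then the left side is zero.\<close>
    then have "\<kappa> * norm (r \<zeta>) \<le> norm \<zeta>"
      by (cases "r \<zeta> = 0") simp_all
    then have "norm (r \<zeta>) \<le> inverse \<kappa> * norm \<zeta>"
      using assms(9) by (simp add: field_simps)
    then have "norm \<xi> * norm (r \<zeta>) \<le> norm \<xi> * (inverse \<kappa> * norm \<zeta>)"
      by (simp add: mult_left_mono)
    moreover have "blinfun_apply \<xi> (r \<zeta>) \<le> norm \<xi> * norm (r \<zeta>)"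
      using norm_blinfun[of \<xi> "r \<zeta>"] by simp
    ultimately show ?thesis
      using dual[OF that(1)] by (simp add: mult_ac)
  qed
  have lower: "inverse ((norm P)\<^sup>2) * inverse K * (norm \<xi>)\<^sup>2 \<le> s_dual_form \<eta> S \<xi> \<xi>"
    if \<xi>: "\<xi> \<in> Wstar" for \<xi>
  proof -
    define q where "q = s_dual_form \<eta> S \<xi> \<xi>"
    have q: "q = s_form e S (r \<xi>) (r \<xi>)"
      using dual[OF \<xi>] riesz[OF \<xi> r_W] by (simp add: q_def)
    have q0: "0 \<le> q"
      using sym_pos_def_nonneg[OF assms(7)] by (simp add: q s_form_def)
    have PW: "blinfun_apply P v \<in> W" for v
      using assms(3) by (auto simp: is_projector_def)
    \<comment> \<open>Since \<open>\<xi>\<close> factors through the idempotent \<open>P\<close>,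
      its values on the whole space are determined on \<open>W\<close>. The norm of \<open>P\<close>
      enters the lower bound through this identity.\<close>
    have \<xi>P: "blinfun_apply \<xi> v = blinfun_apply \<xi> (blinfun_apply P v)" for v
    proof -
      obtain \<theta> where "\<xi> = \<theta> o\<^sub>L P"
        using \<xi> by (auto simp: assms(4) dual_adjoint_def)
      moreover have "blinfun_apply P (blinfun_apply P v) = blinfun_apply P v"
        using assms(3) PW[of v] by (simp add: is_projector_def)
      ultimately show ?thesis
        by simp
    qed
    have "norm (blinfun_apply \<xi> v) \<le> sqrt (K * q) * norm P * norm v" for v
    proof -
      let ?w = "blinfun_apply P v"
      have "(blinfun_apply \<xi> v)\<^sup>2 = (s_form e S (r \<xi>) ?w)\<^sup>2"
        using \<xi>P[of v] riesz[OF \<xi> PW, of v] by simp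
      also have "\<dots> \<le> s_form e S ?w ?w * q"
        \<comment> \<open>Cauchy-Schwarz is applied to the coefficient vectors of \<open>?w\<close>
          and \<open>r \<xi>\<close>; the second factor is \<open>q\<close>.\<close>
        unfolding q s_form_def by (rule sym_pos_def_Cauchy_Schwarz[OF assms(7)])
      also have "\<dots> \<le> (K * norm ?w * norm ?w) * q"
        using assms(10) PW q0 by (intro mult_right_mono) auto
      also have "\<dots> = (K * q) * (norm ?w)\<^sup>2"
        by (simp add: power2_eq_square)
      also have "\<dots> \<le> (K * q) * (norm P * norm v)\<^sup>2"
        using assms(8) q0 by (intro mult_left_mono power_mono norm_blinfun) auto
      also have "\<dots> = (sqrt (K * q) * norm P * norm v)\<^sup>2"
        using assms(8) q0 by (simp add: power_mult_distrib)
      \<comment> \<open>Both sides are now squares, and the base on the right is nonnegative, so the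
        square root gives a bound on the absolute value.\<close>
      finally show ?thesis
        using assms(8) q0 by (simp add: abs_le_square_iff[symmetric] abs_mult)
    qed
    then have "norm \<xi> \<le> sqrt (K * q) * norm P"
      using assms(8) q0 by (intro norm_blinfun_bound) auto
    then have "(norm \<xi>)\<^sup>2 \<le> (sqrt (K * q) * norm P)\<^sup>2"
      by (simp add: power_mono)
    also have "\<dots> = K * q * (norm P)\<^sup>2"
      using assms(8) q0 by (simp add: power_mult_distrib)
    \<comment> \<open>If \<open>P = 0\<close>, the convention \<open>inverse 0 = 0\<close> makes the
      lower bound zero, so \<open>0 \<le> q\<close> settles it; otherwise division by
      \<open>K\<close> and the squared norm of \<open>P\<close> is legitimate.\<close>
    finally show ?thesis
      using assms(8) q0 unfolding q_def[symmetric]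
      by (cases "P = 0") (simp_all add: field_simps)
  qed
  show ?thesis
    using upper lower by blast
qed

end
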